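(* Let $(G_m)_{m\in\mathbb{Z}}$ be a generalized Fibonacci sequence, let $a,b$ be integers, let $n\ge 0$ be an integer, and let $x$ be a complex number such that $\Delta := 1-L_b x+(-1)^b x^2\neq 0$. Then $$\begin{aligned} \sum_{k=0}^n x^k k^2 G_{a+bk} = {}& -\frac{1}{\Delta}(n+1)^2 x^{n+1} P(1,n+1) \\ & - \frac{1}{\Delta^2} \left[ (2n+3) x^{n+2} P(2,n+2) - x P(2,1) \right] \\ & - \frac{2}{\Delta^3} \left[ x^{n+3} P(3,n+3) - x^2 P(3,2) \right]. \end{aligned}$$
   Context: A generalized Fibonacci sequence is a sequence $(G_m)_{m\in\mathbb{Z}}$ of complex numbers with $G_{m+2}=G_{m+1}+G_m$ for all integers $m$ (with arbitrary seed $G_0,G_1$). $L_m$ is the Lucas number: $L_0=2$, $L_1=1$, $L_{m+2}=L_{m+1}+L_m$ for all integers $m$ (including negative indices). For given $a,b,x$ and $G$, and for integers $v,w\ge 0$, $P(v,w) = \sum_{k=0}^v \binom{v}{k} (-1)^{(b+1)k} x^k G_{a+bw-bk}$. Convention: $x^0=1$, also for $x=0$. *)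

theory Defs
  imports Complex_Main
begin

definition gen_fibonacci :: "(int \<Rightarrow> complex) \<Rightarrow> bool" where
  "gen_fibonacci G \<longleftrightarrow> (\<forall>m. G (m + 2) = G (m + 1) + G m)"

fun lucas_up :: "nat \<Rightarrow> int" where
  "lucas_up 0 = 2"
| "lucas_up (Suc 0) = 1"
| "lucas_up (Suc (Suc n)) = lucas_up (Suc n) + lucas_up n"

(* lucas_down n is the Lucas number of index -n: the recurrence solved for its lowest term,
   starting from L_0 = 2 and L_(-1) = L_1 - L_0 = -1. *)
fun lucas_down :: "nat \<Rightarrow> int" where
  "lucas_down 0 = 2"
| "lucas_down (Suc 0) = -1"
| "lucas_down (Suc (Suc n)) = lucas_down n - lucas_down (Suc n)"

definition lucas :: "int \<Rightarrow> int" where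
  "lucas m = (if m \<ge> 0 then lucas_up (nat m) else lucas_down (nat (- m)))"

lemma lucas_0: "lucas 0 = 2" and lucas_1: "lucas 1 = 1"
  by (simp_all add: lucas_def)

lemma lucas_rec: "lucas (m + 2) = lucas (m + 1) + lucas m"
proof -
  consider n where "m = int n" | "m = -1" | n where "m = - int n - 2"
  proof -
    have "m = int (nat m)" if "m \<ge> 0" using that by simp
    moreover have "m = - int (nat (- m - 2)) - 2" if "m \<le> -2" using that by simp
    moreover have "m \<ge> 0 \<or> m = -1 \<or> m \<le> -2" by arith
    ultimately show thesis using that by blast
  qed
  then show ?thesis
  proof cases
    case (1 n)
    have "nat (m + 2) = Suc (Suc n)" "nat (m + 1) = Suc n" "nat m = n" using 1 by auto
    then show ?thesis using 1 by (simp add: lucas_def)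
  next
    case 2
    then show ?thesis by (simp add: lucas_def)
  next
    case (3 n)
    have "lucas (m + 2) = lucas_down n"
    proof (cases "n = 0")
      case True
      then show ?thesis using 3 by (simp add: lucas_def)
    next
      case False
      have "nat (- (m + 2)) = n" using 3 by simp
      then show ?thesis using 3 False by (simp add: lucas_def)
    qed
    moreover have "lucas (m + 1) = lucas_down (Suc n)"
    proof -
      have "nat (- (m + 1)) = Suc n" using 3 by simp
      then show ?thesis using 3 by (simp add: lucas_def)
    qed
    moreover have "lucas m = lucas_down (Suc (Suc n))"
    proof -
      have "nat (- m) = Suc (Suc n)" using 3 by simp
      then show ?thesis using 3 by (simp add: lucas_def)
    qed
    ultimately show ?thesis by simp
  qed
qed

definition P :: "(int \<Rightarrow> complex) \<Rightarrow> int \<Rightarrow> int \<Rightarrow> complex \<Rightarrow> nat \<Rightarrow> nat \<Rightarrow> complex" where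
  "P G a b x v w =
     (\<Sum>k=0..v. of_nat (v choose k) * (- 1) powi ((b + 1) * int k) * x ^ k
        * G (a + b * int w - b * int k))"

end

(* Write G_k for G (a + b k). The recurrence G_(k+1) = L_b G_k - (-1)^b G_(k-1) says that, on the
   sequence h_k = x^k G_k, the scalar \<Delta> acts as the product (1 - E) T, where E is the shift and
   T = 1 - (-1)^b x^2 E^(-1). Since x^w P(v,w) = (T^v h)_w, every division by \<Delta> raises v by one
   and turns the sum into a telescoping one; three summations by parts remove the weight k^2. *)
theory Submission
  imports Defs
begin

lemma gen_fibonacci_unique:
  assumes F: "gen_fibonacci F" and H: "gen_fibonacci H"
    and "F 0 = H 0" and "F 1 = H 1"
  shows "F m = H m"
proof -
  have F': "F (i + 2) = F (i + 1) + F i" and H': "H (i + 2) = H (i + 1) + H i" for i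
    using F H by (auto simp: gen_fibonacci_def)
  have "F m = H m \<and> F (m + 1) = H (m + 1)"
  proof (induction m rule: int_induct[where k = 0])
    case base
    show ?case using assms by simp
  next
    case (step1 i)
    then show ?case using F'[of i] H'[of i] by (simp add: add.assoc)
  next
    case (step2 i)
    then show ?case using F'[of "i - 1"] H'[of "i - 1"] by (simp add: add.commute)
  qed
  then show ?thesis by simp
qed

text \<open>With \<open>m\<close> fixed and \<open>b\<close> varying, both sides satisfy the
  Fibonacci recurrence, so agreement at \<open>b = 0\<close> and \<open>b = 1\<close>
  suffices.\<close>

lemma gen_fibonacci_lucas:
  assumes "gen_fibonacci G"
  shows "G (m + b) + (- 1) powi b * G (m - b) = of_int (lucas b) * G m"
proof -
  have G: "G (i + 2) = G (i + 1) + G i" for i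
    using assms by (auto simp: gen_fibonacci_def)
  have "gen_fibonacci (\<lambda>b. G (m + b) + (- 1) powi b * G (m - b))"
    unfolding gen_fibonacci_def
  proof
    fix i
    show "G (m + (i + 2)) + (- 1) powi (i + 2) * G (m - (i + 2)) =
      G (m + (i + 1)) + (- 1) powi (i + 1) * G (m - (i + 1)) + (G (m + i) + (- 1) powi i * G (m - i))"
      using G[of "m + i"] G[of "m - i - 2"]
      by (simp add: power_int_add algebra_simps)
  qed
  moreover have "gen_fibonacci (\<lambda>b. of_int (lucas b) * G m)"
    by (simp add: gen_fibonacci_def lucas_rec algebra_simps)
  moreover have "G (m + 1) - G (m - 1) = G m"
    using G[of "m - 1"] by (simp add: add.commute)
  ultimately show ?thesis
    using gen_fibonacci_unique[of "\<lambda>b. G (m + b) + (- 1) powi b * G (m - b)"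
        "\<lambda>b. of_int (lucas b) * G m" b]
    by (simp add: lucas_0 lucas_1)
qed

lemma P_0: "P G a b x 0 w = G (a + b * int w)"
  by (simp add: P_def)

text \<open>Trades a step in \<open>w\<close> for a step in \<open>a\<close>: the backward shift is
  then available as \<open>a - b\<close> even at \<open>w = 0\<close>.\<close>

lemma P_shift: "P G a b x v (Suc w) = P G (a + b) b x v w"
  by (simp add: P_def algebra_simps)

text \<open>Pascal's rule, which in operator form is T^(v+1) = T T^v.\<close>

lemma P_Suc:
  "P G a b x (Suc v) w = P G a b x v w - (- 1) powi b * x * P G (a - b) b x v w"
proof -
  define f where "f k = (- 1) powi ((b + 1) * int k) * x ^ k * G (a + b * int w - b * int k)" for k
  \<comment> \<open>One factor (-1)^(b+1) x comes out as -(-1)^b x, and the index drop by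
    \<open>b\<close> moves into \<open>a\<close>.\<close>
  have f_Suc: "f (Suc k) = - ((- 1) powi b * x) *
      ((- 1) powi ((b + 1) * int k) * x ^ k * G (a - b + b * int w - b * int k))" for k
    by (simp add: f_def power_int_add algebra_simps)
  have P: "P G a b x u w = (\<Sum>k=0..u. of_nat (u choose k) * f k)" for u
    by (simp add: P_def f_def mult.assoc)
  have "P G a b x (Suc v) w = f 0 + (\<Sum>k=0..v. of_nat (Suc v choose Suc k) * f (Suc k))"
    unfolding P by (subst sum.atLeast0_atMost_Suc_shift) simp
  also have "\<dots> = (f 0 + (\<Sum>k=0..v. of_nat (v choose Suc k) * f (Suc k)))
      + (\<Sum>k=0..v. of_nat (v choose k) * f (Suc k))"
    by (simp add: sum.distrib algebra_simps)
  also have "f 0 + (\<Sum>k=0..v. of_nat (v choose Suc k) * f (Suc k))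
      = (\<Sum>k=0..Suc v. of_nat (v choose k) * f k)"
    by (subst sum.atLeast0_atMost_Suc_shift) simp
  \<comment> \<open>The extra top term vanishes, since \<open>v choose Suc v\<close> is 0.\<close>
  also have "\<dots> = P G a b x v w"
    by (simp add: P)
  also have "(\<Sum>k=0..v. of_nat (v choose k) * f (Suc k)) = - ((- 1) powi b * x) * P G (a - b) b x v w"
    by (simp add: f_Suc P_def sum_distrib_left sum_negf algebra_simps)
  finally show ?thesis by simp
qed

text \<open>\<open>P\<close> is a linear combination of values of \<open>G\<close> whose
  coefficients do not depend on \<open>a\<close>, so the three-term relation passes to it
  termwise.\<close>

lemma P_lucas:
  assumes "gen_fibonacci G"
  shows "P G (a + b) b x v w + (- 1) powi b * P G (a - b) b x v w = of_int (lucas b) * P G a b x v w"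
proof -
  define c where "c k = of_nat (v choose k) * (- 1) powi ((b + 1) * int k) * x ^ k" for k
  have P: "P G a' b x v w = (\<Sum>k=0..v. c k * G (a' + b * int w - b * int k))" for a'
    by (simp add: P_def c_def)
  have "G (a + b + b * int w - b * int k) + (- 1) powi b * G (a - b + b * int w - b * int k) =
      of_int (lucas b) * G (a + b * int w - b * int k)" for k
    using gen_fibonacci_lucas[OF assms, of "a + b * int w - b * int k" b]
    by (simp add: algebra_simps)
  then have "c k * G (a + b + b * int w - b * int k)
      + (- 1) powi b * (c k * G (a - b + b * int w - b * int k)) =
      of_int (lucas b) * (c k * G (a + b * int w - b * int k))" for k
    by (simp only: mult.left_commute[of _ "c k"] flip: distrib_left)
  then show ?thesis
    by (simp only: P sum_distrib_left flip: sum.distrib)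
qed

lemma P_difference:
  assumes "gen_fibonacci G"
  shows "(1 - of_int (lucas b) * x + (- 1) powi b * x ^ 2) * P G a b x v w =
    P G a b x (Suc v) w - x * P G a b x (Suc v) (Suc w)"
proof -
  let ?q = "(- 1) powi b :: complex"
  have "P G a b x (Suc v) w - x * P G a b x (Suc v) (Suc w) =
      (1 + ?q * x ^ 2) * P G a b x v w - x * (P G (a + b) b x v w + ?q * P G (a - b) b x v w)"
    \<comment> \<open>Shifting forward and then back, \<open>a + b - b\<close>, returns to
      \<open>a\<close>; this is the source of the term in \<open>x ^ 2\<close>.\<close>
    by (simp only: P_shift P_Suc add_diff_cancel_right') (simp add: algebra_simps power2_eq_square)
  then show ?thesis
    by (simp only: P_lucas[OF assms]) (simp add: algebra_simps)
qed

text \<open>The boundary terms of three summations by parts. The weights k^2, 2k - 1 and 2 are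
  successive differences; extending each intermediate sum by one term produces the coefficients
  \<open>(n + 1) ^ 2\<close> and \<open>2 * n + 3\<close>. Multiplying through by
  \<open>d ^ 3\<close> avoids division.\<close>

lemma sum_squares_difference_chain:
  fixes h :: "nat \<Rightarrow> nat \<Rightarrow> 'a::comm_ring_1"
  assumes h: "\<And>v k. d * h v k = h (Suc v) k - h (Suc v) (Suc k)"
  shows "d ^ 3 * (\<Sum>k=0..n. of_nat k ^ 2 * h 0 k) =
    - (d ^ 2 * of_nat (n + 1) ^ 2 * h 1 (n + 1))
    - d * (of_nat (2 * n + 3) * h 2 (n + 2) - h 2 1)
    - 2 * (h 3 (n + 3) - h 3 2)"
proof (induction n)
  case 0
  \<comment> \<open>The left side is 0 here, so the boundary terms must cancel among
    themselves.\<close>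
  have h11: "d * h 1 1 = h 2 1 - h 2 2" and h22: "d * h 2 2 = h 3 2 - h 3 3"
    using h[of 1 1] h[of 2 2] by (simp_all add: eval_nat_numeral)
  have "d ^ 2 * h 1 1 + d * (3 * h 2 2 - h 2 1) + 2 * (h 3 3 - h 3 2) =
      d * (d * h 1 1) + d * (3 * h 2 2 - h 2 1) - 2 * (d * h 2 2)"
    unfolding h22 by (simp add: algebra_simps power2_eq_square)
  also have "\<dots> = 0"
    unfolding h11 by (simp add: algebra_simps)
  finally show ?case
    by (simp add: algebra_simps flip: numeral_2_eq_2)
next
  case (Suc n)
  let ?N = "of_nat n :: 'a"
  have h0: "d * h 0 (n + 1) = h 1 (n + 1) - h 1 (n + 2)"
    and h1: "d * h 1 (n + 2) = h 2 (n + 2) - h 2 (n + 3)"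
    and h2: "d * h 2 (n + 3) = h 3 (n + 3) - h 3 (n + 4)"
    using h[of 0 "n + 1"] h[of 1 "n + 2"] h[of 2 "n + 3"] by (simp_all add: eval_nat_numeral)
  \<comment> \<open>The new summand is pushed down the chain level by level, using (N+2)^2 - (N+1)^2
    = 2N + 3 and then (2N+5) - (2N+3) = 2.\<close>
  have "d ^ 3 * ((?N + 1) ^ 2 * h 0 (n + 1)) = d ^ 2 * (?N + 1) ^ 2 * (d * h 0 (n + 1))"
    by (simp add: algebra_simps eval_nat_numeral)
  also have "\<dots> = d ^ 2 * (?N + 1) ^ 2 * h 1 (n + 1) - d ^ 2 * (?N + 2) ^ 2 * h 1 (n + 2)
      + d * (2 * ?N + 3) * (d * h 1 (n + 2))"
    unfolding h0 by (simp add: algebra_simps power2_eq_square)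
  also have "d * (2 * ?N + 3) * (d * h 1 (n + 2)) =
      d * (2 * ?N + 3) * h 2 (n + 2) - d * (2 * ?N + 5) * h 2 (n + 3) + 2 * (d * h 2 (n + 3))"
    unfolding h1 by (simp add: algebra_simps)
  finally have "d ^ 3 * ((?N + 1) ^ 2 * h 0 (n + 1)) =
      d ^ 2 * (?N + 1) ^ 2 * h 1 (n + 1) - d ^ 2 * (?N + 2) ^ 2 * h 1 (n + 2)
      + d * (2 * ?N + 3) * h 2 (n + 2) - d * (2 * ?N + 5) * h 2 (n + 3)
      + 2 * h 3 (n + 3) - 2 * h 3 (n + 4)"
    unfolding h2 by (simp add: algebra_simps)
  with Suc.IH show ?case
    by (simp add: distrib_left numeral_eq_Suc) (simp add: algebra_simps)
qed

theorem mainTheorem3: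
  fixes G :: "int \<Rightarrow> complex" and a b :: int and n :: nat and x \<Delta> :: complex
  assumes "gen_fibonacci G"
    and "\<Delta> = 1 - of_int (lucas b) * x + (- 1) powi b * x ^ 2"
    and "\<Delta> \<noteq> 0"
  shows "(\<Sum>k=0..n. x ^ k * of_nat k ^ 2 * G (a + b * int k)) =
      - (1 / \<Delta>) * of_nat (n + 1) ^ 2 * x ^ (n + 1) * P G a b x 1 (n + 1)
      - (1 / \<Delta> ^ 2) * (of_nat (2 * n + 3) * x ^ (n + 2) * P G a b x 2 (n + 2) - x * P G a b x 2 1)
      - (2 / \<Delta> ^ 3) * (x ^ (n + 3) * P G a b x 3 (n + 3) - x ^ 2 * P G a b x 3 2)"
proof -
  \<comment> \<open>The factor \<open>x ^ k\<close> absorbs the \<open>x\<close> in front of the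
    shifted term of \<open>P_difference\<close>, leaving a pure difference.\<close>
  define h where "h v k = x ^ k * P G a b x v k" for v k
  have "\<Delta> * h v k = h (Suc v) k - h (Suc v) (Suc k)" for v k
  proof -
    have "\<Delta> * P G a b x v k = P G a b x (Suc v) k - x * P G a b x (Suc v) (Suc k)"
      unfolding assms(2) by (rule P_difference[OF assms(1)])
    then have "x ^ k * (\<Delta> * P G a b x v k) =
        x ^ k * (P G a b x (Suc v) k - x * P G a b x (Suc v) (Suc k))"
      by (rule arg_cong)
    then show ?thesis
      by (simp only: h_def right_diff_distrib power_Suc mult_ac)
  qed
  note chain = sum_squares_difference_chain[of \<Delta> h, OF this, of n]
  define A B C where "A = of_nat (n + 1) ^ 2 * h 1 (n + 1)"
    and "B = of_nat (2 * n + 3) * h 2 (n + 2) - h 2 1"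
    and "C = h 3 (n + 3) - h 3 2"
  have "(\<Sum>k=0..n. x ^ k * of_nat k ^ 2 * G (a + b * int k)) = (\<Sum>k=0..n. of_nat k ^ 2 * h 0 k)"
    by (simp add: h_def P_0 mult_ac)
  \<comment> \<open>Only from here on is \<Delta> \<noteq> 0 used, to divide by
    \<open>\<Delta> ^ 3\<close>.\<close>
  also have "\<dots> = (- (\<Delta> ^ 2 * A) - \<Delta> * B - 2 * C) / \<Delta> ^ 3"
    using chain assms(3) unfolding A_def B_def C_def
    by (subst nonzero_eq_divide_eq) (simp_all only: power_eq_0_iff mult_ac, simp_all)
  also have "\<dots> = - (1 / \<Delta>) * A - (1 / \<Delta> ^ 2) * B - (2 / \<Delta> ^ 3) * C"
    using assms(3) by (simp add: diff_divide_distrib power2_eq_square power3_eq_cube)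
  finally show ?thesis
    by (simp only: A_def B_def C_def h_def mult.assoc power_one_right)
qed

end
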